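(* Let $m\ge n\ge 1$ be integers and let $p=(p_1,\dots,p_m)$ with $0<p_1\le p_2\le\dots\le p_m<1$. Let $\tilde p_i=p_i\prod_{j\neq i}(1-p_j)$ and let $i(p)$ be the index of $p$ (defined in the context). Let $f=(f_i)_{i=1}^m$ be a Parseval frame in $\mathbb{R}^n$. Then $f\in\mathcal{E}_{p,1}(m,n)$ if and only if $$\|f_i\|^2=\frac{n-i(p)}{\tilde p_i\sum_{k=i(p)+1}^m\frac1{\tilde p_k}}\quad\text{for all } i\ge i(p)+1,\qquad\text{and}\qquad \|f_i\|=1\quad\text{for all } i\le i(p).$$
   Context: A Parseval frame in $\mathbb{R}^n$ with $m$ vectors is a sequence $(f_i)_{i=1}^m\subset\mathbb{R}^n$ with $\sum_{i=1}^m|\langle x,f_i\rangle|^2=\|x\|^2$ for all $x\in\mathbb{R}^n$; the set of these is denoted $\mathcal{P}(m,n)$. For $f\in\mathcal P(m,n)$ put $d_{p,1}(f)=\max_{1\le i\le m}\|f_if_i^*\|\,p_i\prod_{j\ne i}(1-p_j)=\max_{1\le i\le m}\tilde p_i\|f_i\|^2$. Let $e_{p,1}(m,n)=\inf_{f\in\mathcal{P}(m,n)}d_{p,1}(f)$ and $\mathcal{E}_{p,1}(m,n)=\{f\in\mathcal{P}(m,n): d_{p,1}(f)=e_{p,1}(m,n)\}$. Condition (H) for $\tilde p=(\tilde p_1,\dots,\tilde p_m)$: $\tilde p_i\ge \dfrac{n}{\sum_{k=1}^m 1/\tilde p_k}$ for all $i=1,\dots,m$. Index of $p$: $i(p)=0$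 if $\tilde p$ satisfies (H); otherwise $i(p)=\max\{j\in\{1,\dots,m\}:\ \tilde p_j\sum_{k=j+1}^m\frac1{\tilde p_k}<n-j\}$ (this set is nonempty in that case). *)

theory Defs
  imports "HOL-Analysis.Analysis"
begin

text \<open>
  Sequences of length \<open>m\<close> (frames and probability vectors) are functions on \<open>nat\<close> of which only
  the values at the indices \<open>1, \<dots>, m\<close> matter; \<open>\<real>\<^sup>n\<close> is \<^typ>\<open>real ^ 'n\<close> with \<open>n = CARD('n)\<close>.
\<close>

definition parseval_frames :: "nat \<Rightarrow> (nat \<Rightarrow> real ^ 'n) set" where
  "parseval_frames m = {f. \<forall>x. (\<Sum>i=1..m. \<bar>x \<bullet> f i\<bar>\<^sup>2) = (norm x)\<^sup>2}"

definition ptilde :: "nat \<Rightarrow> (nat \<Rightarrow> real) \<Rightarrow> nat \<Rightarrow> real" where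
  "ptilde m p i = p i * (\<Prod>j\<in>{1..m} - {i}. 1 - p j)"

definition rank_one :: "real ^ 'n \<Rightarrow> real ^ 'n \<Rightarrow> real ^ 'n" where
  "rank_one v = (\<lambda>x. (x \<bullet> v) *\<^sub>R v)"

definition d_err :: "nat \<Rightarrow> (nat \<Rightarrow> real) \<Rightarrow> (nat \<Rightarrow> real ^ 'n) \<Rightarrow> real" where
  "d_err m p f = (MAX i\<in>{1..m}. onorm (rank_one (f i)) * p i * (\<Prod>j\<in>{1..m} - {i}. 1 - p j))"

text \<open>
  The set of Parseval frames is nonempty for \<open>m \<ge> n\<close>, and \<open>d_err\<close> is bounded below by \<open>0\<close> on it
  when \<open>m \<ge> 1\<close> and \<open>0 < p\<^sub>i < 1\<close>, so the infimum below is then a genuine one.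
\<close>

definition e_err :: "'n::finite itself \<Rightarrow> nat \<Rightarrow> (nat \<Rightarrow> real) \<Rightarrow> real" where
  "e_err _ m p = (INF f\<in>(parseval_frames m :: (nat \<Rightarrow> real ^ 'n) set). d_err m p f)"

definition optimal_frames :: "nat \<Rightarrow> (nat \<Rightarrow> real) \<Rightarrow> (nat \<Rightarrow> real ^ 'n) set" where
  "optimal_frames m p = {f \<in> parseval_frames m. d_err m p f = e_err TYPE('n) m p}"

definition condition_H :: "nat \<Rightarrow> nat \<Rightarrow> (nat \<Rightarrow> real) \<Rightarrow> bool" where
  "condition_H m n q \<longleftrightarrow> (\<forall>i\<in>{1..m}. q i \<ge> real n / (\<Sum>k=1..m. 1 / q k))"

text \<open>
  The set under \<open>Max\<close> is nonempty when \<open>p\<close> is nondecreasing with values in \<open>(0, 1)\<close> and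
  \<open>condition_H\<close> fails: it then contains \<open>1\<close>.
\<close>

definition frame_index :: "nat \<Rightarrow> nat \<Rightarrow> (nat \<Rightarrow> real) \<Rightarrow> nat" where
  "frame_index m n p =
    (if condition_H m n (ptilde m p) then 0
     else Max {j\<in>{1..m}. ptilde m p j * (\<Sum>k=j+1..m. 1 / ptilde m p k) < real n - real j})"

lemma onorm_rank_one: "onorm (rank_one v) = (norm v)\<^sup>2"
proof (rule antisym)
  show "onorm (rank_one v) \<le> (norm v)\<^sup>2"
  proof (rule onorm_bound)
    fix x
    have "norm (rank_one v x) \<le> (norm x * norm v) * norm v"
      unfolding rank_one_def norm_scaleR
      by (intro mult_right_mono) (auto simp: Cauchy_Schwarz_ineq2)
    then show "norm (rank_one v x) \<le> (norm v)\<^sup>2 * norm x"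
      by (simp add: power2_eq_square mult_ac)
  qed simp
  have "bounded_linear (rank_one v)"
    unfolding rank_one_def
    by (intro bounded_linear_scaleR_left[THEN bounded_linear_compose] bounded_linear_inner_left)
  from onorm[OF this, of v] show "(norm v)\<^sup>2 \<le> onorm (rank_one v)"
    by (cases "v = 0")
      (auto simp: rank_one_def dot_square_norm power2_eq_square onorm_zero)
qed

text \<open>The two expressions for the error agree:\<close>

lemma d_err_alt: "d_err m p f = (MAX i\<in>{1..m}. ptilde m p i * (norm (f i))\<^sup>2)"
  by (simp add: d_err_def ptilde_def onorm_rank_one mult_ac)

end

theory Submission
  imports Defs
begin

text \<open>
  Write \<open>q\<close> for \<open>ptilde m p\<close>, \<open>n\<close> for the dimension and \<open>r\<close> for the index of \<open>p\<close>. The squared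
  norms \<open>\<parallel>f\<^sub>i\<parallel>\<^sup>2\<close> of a Parseval frame lie in \<open>[0, 1]\<close> and add up to \<open>n\<close>, so minimising
  \<open>MAX i. q\<^sub>i \<parallel>f\<^sub>i\<parallel>\<^sup>2\<close> is a water-filling problem: an error of at most \<open>L\<close> forces
  \<open>\<parallel>f\<^sub>i\<parallel>\<^sup>2 \<le> min 1 (L / q\<^sub>i)\<close>, and the best conceivable \<open>L\<close> is the one at which these caps add
  up to exactly \<open>n\<close>.

  The index locates that level. With \<open>L = (n - r) / (\<Sum>k>r. 1 / q\<^sub>k)\<close> one has \<open>q\<^sub>i < L\<close> for
  \<open>i \<le> r\<close> and \<open>L \<le> q\<^sub>i\<close> for \<open>i > r\<close> (\<open>below_index_less_level\<close>, \<open>level_le_above_index\<close>), so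
  the caps are \<open>1\<close> up to \<open>r\<close> and \<open>L / q\<^sub>i\<close> afterwards, with sum \<open>r + (n - r) = n\<close>. A frame of
  error at most \<open>L\<close> has squared norms below the caps and with the same sum, hence equal to them;
  conversely these norms give error exactly \<open>L\<close>. Therefore \<open>L\<close> is a lower bound for the error,
  attained precisely by the frames with the stated norms.

  It remains to see that some frame has these norms, so that \<open>L\<close> really is the infimum. This is
  the easy half of the Schur--Horn theorem (\<open>parseval_frame_with_norms_exists\<close>): starting from
  an orthonormal basis padded with zero vectors, rotations in the plane of two indices keep the
  Parseval property and move squared norm from one index to the other.
\<close>

section \<open>Norms of the vectors of a Parseval frame\<close>

lemma parseval_framesD:
  fixes f :: "nat \<Rightarrow> real ^ 'n"
  assumes "f \<in> parseval_frames m"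
  shows "(\<Sum>i=1..m. (x \<bullet> f i)\<^sup>2) = (norm x)\<^sup>2"
  using assms by (simp add: parseval_frames_def)

lemma parseval_norm_le_1:
  fixes f :: "nat \<Rightarrow> real ^ 'n"
  assumes "f \<in> parseval_frames m" "i \<in> {1..m}"
  shows "(norm (f i))\<^sup>2 \<le> 1"
proof -
  \<comment> \<open>Testing the Parseval identity on \<open>f i\<close> itself gives \<open>\<parallel>f i\<parallel>\<^sup>4 \<le> \<parallel>f i\<parallel>\<^sup>2\<close>.\<close>
  have "(f i \<bullet> f i)\<^sup>2 \<le> (\<Sum>k=1..m. (f i \<bullet> f k)\<^sup>2)"
    using assms(2) by (intro member_le_sum) auto
  also have "\<dots> = (norm (f i))\<^sup>2"
    by (rule parseval_framesD[OF assms(1)])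
  finally have "(norm (f i))\<^sup>2 * (norm (f i))\<^sup>2 \<le> 1 * (norm (f i))\<^sup>2"
    by (simp only: dot_square_norm power2_eq_square mult_1)
  then show ?thesis
    by (cases "f i = 0") (simp, simp only: mult_le_cancel_right, simp)
qed

text \<open>Both sides are the trace of the frame operator, which is the identity.\<close>

lemma parseval_sum_norms:
  fixes f :: "nat \<Rightarrow> real ^ 'n"
  assumes "f \<in> parseval_frames m"
  shows "(\<Sum>i=1..m. (norm (f i))\<^sup>2) = real CARD('n)"
proof -
  have "(\<Sum>i=1..m. (norm (f i))\<^sup>2) = (\<Sum>i=1..m. \<Sum>k\<in>UNIV. (axis k 1 \<bullet> f i)\<^sup>2)"
    unfolding power2_norm_eq_inner
    by (simp add: inner_vec_def[of "f _" "f _"] power2_eq_square inner_axis')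
  also have "\<dots> = (\<Sum>k\<in>UNIV. \<Sum>i=1..m. (axis k 1 \<bullet> f i)\<^sup>2)"
    by (rule sum.swap)
  also have "\<dots> = real CARD('n)"
    by (simp only: parseval_framesD[OF assms]) simp
  finally show ?thesis .
qed

section \<open>Parseval frames with prescribed norms\<close>

lemma padded_basis_parseval:
  assumes "CARD('n) \<le> m"
  shows "\<exists>g \<in> (parseval_frames m :: (nat \<Rightarrow> real ^ 'n) set).
           (\<forall>i\<in>{1..CARD('n)}. (norm (g i))\<^sup>2 = 1) \<and> (\<forall>i\<in>{CARD('n)+1..m}. (norm (g i))\<^sup>2 = 0)"
proof -
  obtain h :: "nat \<Rightarrow> 'n" where h: "bij_betw h {1..CARD('n)} UNIV"
    using ex_bij_betw_nat_finite_1[of "UNIV :: 'n set"] by auto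
  define g :: "nat \<Rightarrow> real ^ 'n" where "g i = (if i \<le> CARD('n) then axis (h i) 1 else 0)" for i
  have "(\<Sum>i=1..m. \<bar>x \<bullet> g i\<bar>\<^sup>2) = (norm x)\<^sup>2" for x
  proof -
    have "(\<Sum>i=1..m. \<bar>x \<bullet> g i\<bar>\<^sup>2) = (\<Sum>i=1..CARD('n). (x $ h i)\<^sup>2)"
      by (rule sum.mono_neutral_cong_right) (use assms in \<open>auto simp: g_def inner_axis\<close>)
    also have "\<dots> = (\<Sum>k\<in>UNIV. (x $ k)\<^sup>2)"
      by (rule sum.reindex_bij_betw[OF h])
    also have "\<dots> = (norm x)\<^sup>2"
      unfolding power2_norm_eq_inner by (simp add: inner_vec_def power2_eq_square)
    finally show ?thesis .
  qed
  then show ?thesis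
    by (intro bexI[of _ g]) (auto simp: parseval_frames_def g_def)
qed

text \<open>
  Replacing \<open>f i\<close> and \<open>f j\<close> by \<open>cos \<theta> f i + sin \<theta> f j\<close> and \<open>- sin \<theta> f i + cos \<theta> f j\<close> changes
  neither \<open>(x \<bullet> f i)\<^sup>2 + (x \<bullet> f j)\<^sup>2\<close> nor the sum of the two squared norms. As \<open>\<theta>\<close> runs from \<open>0\<close> to
  \<open>\<pi> / 2\<close>, the new \<open>i\<close>-th vector moves from \<open>f i\<close> to \<open>f j\<close>, so its squared norm takes every value
  in between.
\<close>

lemma parseval_transfer_norm:
  fixes f :: "nat \<Rightarrow> real ^ 'n"
  assumes f: "f \<in> parseval_frames m" and ij: "i \<in> {1..m}" "j \<in> {1..m}" "i \<noteq> j"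
    and t: "(norm (f j))\<^sup>2 \<le> t" "t \<le> (norm (f i))\<^sup>2"
  obtains g where "g \<in> parseval_frames m" "(norm (g i))\<^sup>2 = t"
    "(norm (g j))\<^sup>2 = (norm (f i))\<^sup>2 + (norm (f j))\<^sup>2 - t"
    "\<And>k. k \<noteq> i \<Longrightarrow> k \<noteq> j \<Longrightarrow> g k = f k"
proof -
  define \<phi> where "\<phi> \<theta> = (norm (cos \<theta> *\<^sub>R f i + sin \<theta> *\<^sub>R f j))\<^sup>2" for \<theta>
  have "\<exists>\<theta>\<ge>0. \<theta> \<le> pi / 2 \<and> \<phi> \<theta> = t"
    by (rule IVT2') (use t in \<open>auto simp: \<phi>_def intro!: continuous_intros\<close>)
  then obtain \<theta> where \<theta>: "\<phi> \<theta> = t" by blast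
  define c s where "c = cos \<theta>" and "s = sin \<theta>"
  have cs: "c\<^sup>2 = 1 - s\<^sup>2"
    by (simp add: c_def s_def cos_squared_eq)
  define g where "g = f(i := c *\<^sub>R f i + s *\<^sub>R f j, j := c *\<^sub>R f j - s *\<^sub>R f i)"
  have gi: "g i = c *\<^sub>R f i + s *\<^sub>R f j" and gj: "g j = c *\<^sub>R f j - s *\<^sub>R f i"
    using ij(3) by (simp_all add: g_def)
  have g_other: "g k = f k" if "k \<noteq> i" "k \<noteq> j" for k
    using that by (simp add: g_def)
  have rot: "(c * u + s * v)\<^sup>2 + (c * v - s * u)\<^sup>2 = u\<^sup>2 + v\<^sup>2" for u v
  proof -
    have "(c * u + s * v)\<^sup>2 + (c * v - s * u)\<^sup>2 = c\<^sup>2 * (u\<^sup>2 + v\<^sup>2) + s\<^sup>2 * (u\<^sup>2 + v\<^sup>2)"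
      by (simp add: power2_eq_square algebra_simps)
    then show ?thesis by (simp add: cs algebra_simps)
  qed
  have split: "(\<Sum>k=1..m. F k) = F i + F j + (\<Sum>k\<in>{1..m} - {i, j}. F k)" for F :: "nat \<Rightarrow> real"
  proof -
    have "(\<Sum>k=1..m. F k) = (\<Sum>k\<in>{1..m} - {i, j}. F k) + (\<Sum>k\<in>{i, j}. F k)"
      by (rule sum.subset_diff) (use ij in auto)
    then show ?thesis using ij(3) by simp
  qed
  have "(\<Sum>k=1..m. (x \<bullet> g k)\<^sup>2) = (norm x)\<^sup>2" for x
  proof -
    have "(x \<bullet> g i)\<^sup>2 + (x \<bullet> g j)\<^sup>2 = (x \<bullet> f i)\<^sup>2 + (x \<bullet> f j)\<^sup>2"
      using rot[of "x \<bullet> f i" "x \<bullet> f j"]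
      by (simp add: gi gj inner_add_right inner_diff_right)
    moreover have "(\<Sum>k\<in>{1..m} - {i, j}. (x \<bullet> g k)\<^sup>2) = (\<Sum>k\<in>{1..m} - {i, j}. (x \<bullet> f k)\<^sup>2)"
      by (rule sum.cong) (auto simp: g_other)
    ultimately show ?thesis
      using parseval_framesD[OF f, of x] by (simp only: split)
  qed
  then have g: "g \<in> parseval_frames m"
    by (simp add: parseval_frames_def)
  have norm_gi: "(norm (g i))\<^sup>2 = t"
    using \<theta> by (simp add: \<phi>_def gi c_def s_def)
  have "(norm (g i))\<^sup>2 + (norm (g j))\<^sup>2 = (norm (f i))\<^sup>2 + (norm (f j))\<^sup>2"
  proof -
    have "(norm (g i))\<^sup>2 + (norm (g j))\<^sup>2
        = c\<^sup>2 * (f i \<bullet> f i + f j \<bullet> f j) + s\<^sup>2 * (f i \<bullet> f i + f j \<bullet> f j)"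
      unfolding power2_norm_eq_inner gi gj
      by (simp add: algebra_simps inner_commute power2_eq_square)
    then show ?thesis
      by (simp add: cs algebra_simps power2_norm_eq_inner)
  qed
  then have "(norm (g j))\<^sup>2 = (norm (f i))\<^sup>2 + (norm (f j))\<^sup>2 - t"
    using norm_gi by simp
  with g norm_gi g_other show thesis using that by blast
qed

text \<open>
  Norm is moved only from indices with an excess, all at most \<open>l\<close>, to indices with a deficit, all
  above \<open>l\<close>. Because \<open>a\<close> is at least as large on the former as on the latter, the values to be
  reached lie between the two current squared norms, so \<open>parseval_transfer_norm\<close> applies. Moving
  the smaller of excess and deficit makes one more index correct and creates no new
  discrepancy, hence the induction on the number of incorrect indices.
\<close>

lemma parseval_adjust_norms:
  fixes f :: "nat \<Rightarrow> real ^ 'n"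
  assumes "f \<in> parseval_frames m"
    and sum_a: "(\<Sum>i=1..m. a i) = real CARD('n)"
    and anti: "\<And>i j. i \<in> {1..l} \<Longrightarrow> j \<in> {l+1..m} \<Longrightarrow> a j \<le> a i"
    and "l \<le> m"
    and "\<And>i. i \<in> {1..l} \<Longrightarrow> a i \<le> (norm (f i))\<^sup>2"
    and "\<And>j. j \<in> {l+1..m} \<Longrightarrow> (norm (f j))\<^sup>2 \<le> a j"
  shows "\<exists>g \<in> (parseval_frames m :: (nat \<Rightarrow> real ^ 'n) set). \<forall>i\<in>{1..m}. (norm (g i))\<^sup>2 = a i"
  using assms(1,5,6)
proof (induction "card {i\<in>{1..m}. (norm (f i))\<^sup>2 \<noteq> a i}" arbitrary: f rule: less_induct)
  case less
  let ?b = "\<lambda>i. (norm (f i))\<^sup>2"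
  let ?bad = "\<lambda>f :: nat \<Rightarrow> real ^ 'n. {i\<in>{1..m}. (norm (f i))\<^sup>2 \<noteq> a i}"
  have sum_b: "(\<Sum>i=1..m. ?b i) = (\<Sum>i=1..m. a i)"
    using parseval_sum_norms[OF less.prems(1)] sum_a by simp
  show ?case
  proof (cases "?bad f = {}")
    case True
    then show ?thesis using less.prems(1) by blast
  next
    case False
    have "\<exists>i\<in>{1..m}. a i < ?b i"
    proof (rule ccontr)
      assume "\<not> ?thesis"
      then have le: "\<And>i. i \<in> {1..m} \<Longrightarrow> ?b i \<le> a i" by force
      from False obtain k where "k \<in> {1..m}" "?b k \<noteq> a k" by blast
      then have "\<exists>k\<in>{1..m}. ?b k < a k" using le by force
      then have "(\<Sum>i=1..m. ?b i) < (\<Sum>i=1..m. a i)"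
        using le by (intro sum_strict_mono_ex1) auto
      then show False using sum_b by simp
    qed
    then obtain i where i: "i \<in> {1..m}" "a i < ?b i" by blast
    have "\<exists>j\<in>{1..m}. ?b j < a j"
    proof (rule ccontr)
      assume "\<not> ?thesis"
      then have "\<And>i. i \<in> {1..m} \<Longrightarrow> a i \<le> ?b i" by force
      then have "(\<Sum>i=1..m. a i) < (\<Sum>i=1..m. ?b i)"
        using i by (intro sum_strict_mono_ex1) auto
      then show False using sum_b by simp
    qed
    then obtain j where j: "j \<in> {1..m}" "?b j < a j" by blast
    have il: "i \<in> {1..l}"
      using less.prems(3)[of i] i by (cases "i \<le> l") auto
    have jl: "j \<in> {l+1..m}"
      using less.prems(2)[of j] j by (cases "j \<le> l") auto
    have "i \<noteq> j" using il jl by auto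
    have aji: "a j \<le> a i" by (rule anti[OF il jl])
    define \<delta> where "\<delta> = min (?b i - a i) (a j - ?b j)"
    have \<delta>: "0 < \<delta>" "\<delta> \<le> ?b i - a i" "\<delta> \<le> a j - ?b j"
      "\<delta> = ?b i - a i \<or> \<delta> = a j - ?b j"
      using i(2) j(2) by (auto simp: \<delta>_def min_def)
    obtain g where g: "g \<in> parseval_frames m" "(norm (g i))\<^sup>2 = ?b i - \<delta>"
      "(norm (g j))\<^sup>2 = ?b i + ?b j - (?b i - \<delta>)"
      and g_other: "\<And>k. k \<noteq> i \<Longrightarrow> k \<noteq> j \<Longrightarrow> g k = f k"
    proof (rule parseval_transfer_norm[OF less.prems(1) i(1) j(1) \<open>i \<noteq> j\<close>])
      show "?b j \<le> ?b i - \<delta>" using \<delta> aji j(2) by linarith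
      show "?b i - \<delta> \<le> ?b i" using \<delta>(1) by simp
    qed (use that in blast)
    have gj: "(norm (g j))\<^sup>2 = ?b j + \<delta>" using g(3) by simp
    have "?bad g \<subset> ?bad f"
    proof
      show "?bad g \<subseteq> ?bad f"
      proof
        fix k assume k: "k \<in> ?bad g"
        consider "k = i" | "k = j" | "k \<noteq> i" "k \<noteq> j" by blast
        then show "k \<in> ?bad f"
          using k i j by cases (auto simp: g_other)
      qed
      show "?bad g \<noteq> ?bad f"
        using \<delta>(4) g(2) gj i j by fastforce
    qed
    then have smaller: "card (?bad g) < card (?bad f)"
      by (intro psubset_card_mono) auto
    show ?thesis
    proof (rule less.hyps[OF smaller g(1)])
      fix k assume k: "k \<in> {1..l}"
      then have "k \<noteq> j" using jl by auto
      then show "a k \<le> (norm (g k))\<^sup>2"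
        using less.prems(2)[OF k] g(2) \<delta>(2) by (cases "k = i") (auto simp: g_other)
    next
      fix k assume k: "k \<in> {l+1..m}"
      then have "k \<noteq> i" using il by auto
      then show "(norm (g k))\<^sup>2 \<le> a k"
        using less.prems(3)[OF k] gj \<delta>(3) by (cases "k = j") (auto simp: g_other)
    qed
  qed
qed

text \<open>
  An orthonormal basis padded with zeros has norms at least \<open>a\<close> on the first \<open>n\<close> indices and at
  most \<open>a\<close> on the others, which is all that \<open>parseval_adjust_norms\<close> asks of its starting point.
\<close>

lemma parseval_frame_with_norms_exists:
  assumes "CARD('n) \<le> m"
    and a01: "\<And>i. i \<in> {1..m} \<Longrightarrow> 0 \<le> a i \<and> a i \<le> 1"
    and anti: "\<And>i j. i \<in> {1..m} \<Longrightarrow> j \<in> {1..m} \<Longrightarrow> i \<le> j \<Longrightarrow> a j \<le> a i"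
    and "(\<Sum>i=1..m. a i) = real CARD('n)"
  shows "\<exists>g \<in> (parseval_frames m :: (nat \<Rightarrow> real ^ 'n) set). \<forall>i\<in>{1..m}. (norm (g i))\<^sup>2 = a i"
proof -
  obtain g :: "nat \<Rightarrow> real ^ 'n" where g: "g \<in> parseval_frames m"
    "\<And>i. i \<in> {1..CARD('n)} \<Longrightarrow> (norm (g i))\<^sup>2 = 1"
    "\<And>i. i \<in> {CARD('n)+1..m} \<Longrightarrow> (norm (g i))\<^sup>2 = 0"
    using padded_basis_parseval[OF assms(1)] by blast
  show ?thesis
  proof (rule parseval_adjust_norms[OF g(1) assms(4) _ assms(1)])
    show "a j \<le> a i" if "i \<in> {1..CARD('n)}" "j \<in> {CARD('n)+1..m}" for i j
      using anti[of i j] that assms(1) by auto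
    show "a i \<le> (norm (g i))\<^sup>2" if "i \<in> {1..CARD('n)}" for i
      using a01[of i] g(2)[OF that] that assms(1) by auto
    show "(norm (g j))\<^sup>2 \<le> a j" if "j \<in> {CARD('n)+1..m}" for j
      using a01[of j] g(3)[OF that] that by auto
  qed
qed

section \<open>The index and the water level\<close>

lemma ptilde_pos:
  assumes "\<forall>i\<in>{1..m}. 0 < p i \<and> p i < 1" "i \<in> {1..m}"
  shows "0 < ptilde m p i"
  unfolding ptilde_def using assms by (intro mult_pos_pos prod_pos) auto

text \<open>
  The factors of \<open>ptilde m p i\<close> and \<open>ptilde m p j\<close> agree except that the former has
  \<open>p i * (1 - p j)\<close> where the latter has \<open>p j * (1 - p i)\<close>.
\<close>

lemma ptilde_mono:
  assumes p: "\<forall>i\<in>{1..m}. 0 < p i \<and> p i < 1"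
    and ij: "i \<in> {1..m}" "j \<in> {1..m}" and le: "p i \<le> p j"
  shows "ptilde m p i \<le> ptilde m p j"
proof (cases "i = j")
  case False
  define R where "R = (\<Prod>k\<in>{1..m} - {i, j}. 1 - p k)"
  have "R > 0"
    unfolding R_def using p by (intro prod_pos) auto
  have "ptilde m p i = p i * (1 - p j) * R"
  proof -
    have eq: "{1..m} - {i} = insert j ({1..m} - {i, j})" using ij False by auto
    have "(\<Prod>k\<in>{1..m} - {i}. 1 - p k) = (1 - p j) * R"
      unfolding R_def eq by (rule prod.insert) auto
    then show ?thesis by (simp add: ptilde_def)
  qed
  moreover have "ptilde m p j = p j * (1 - p i) * R"
  proof -
    have eq: "{1..m} - {j} = insert i ({1..m} - {i, j})" using ij False by auto
    have "(\<Prod>k\<in>{1..m} - {j}. 1 - p k) = (1 - p i) * R"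
      unfolding R_def eq by (rule prod.insert) auto
    then show ?thesis by (simp add: ptilde_def)
  qed
  moreover have "p i * (1 - p j) * R \<le> p j * (1 - p i) * R"
    using le \<open>R > 0\<close> by (intro mult_right_mono) (auto simp: algebra_simps)
  ultimately show ?thesis by simp
qed simp

text \<open>
  The water-filling argument sees \<open>p\<close> only through the weights \<open>q\<close>, which inherit positivity and
  monotonicity from \<open>p\<close>. The dimension enters as a number \<open>n\<close>, so that the index and the level
  can be studied apart from frames.
\<close>

locale weights =
  fixes m n :: nat and p :: "nat \<Rightarrow> real"
  assumes n_pos: "1 \<le> n" and n_le_m: "n \<le> m"
    and p01: "\<forall>i\<in>{1..m}. 0 < p i \<and> p i < 1"
    and p_mono: "\<forall>i\<in>{1..m}. \<forall>j\<in>{1..m}. i \<le> j \<longrightarrow> p i \<le> p j"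
begin

abbreviation q :: "nat \<Rightarrow> real" where "q \<equiv> ptilde m p"

definition tail :: "nat \<Rightarrow> real" where "tail j = (\<Sum>k=j+1..m. 1 / q k)"

abbreviation r :: nat where "r \<equiv> frame_index m n p"

text \<open>
  The value of \<open>L\<close> at which the caps \<open>min 1 (L / q i)\<close> add up to \<open>n\<close>, provided that exactly the
  first \<open>r\<close> of them are cut off at \<open>1\<close>.
\<close>

definition level :: real where "level = (real n - real r) / tail r"

lemma q_pos: "i \<in> {1..m} \<Longrightarrow> 0 < q i"
  using ptilde_pos[OF p01] .

lemma q_mono: "i \<in> {1..m} \<Longrightarrow> j \<in> {1..m} \<Longrightarrow> i \<le> j \<Longrightarrow> q i \<le> q j"
  using ptilde_mono[OF p01] p_mono by blast

lemma tail_nonneg: "0 \<le> tail j"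
  unfolding tail_def by (intro sum_nonneg) (use q_pos in \<open>fastforce simp: less_imp_le\<close>)

lemma tail_Suc: "j < m \<Longrightarrow> tail j = 1 / q (Suc j) + tail (Suc j)"
  unfolding tail_def by (simp add: sum.atLeast_Suc_atMost)

lemma tail_pos: "j < m \<Longrightarrow> 0 < tail j"
  using tail_Suc[of j] tail_nonneg[of "Suc j"] q_pos[of "Suc j"]
  by (simp add: add_pos_nonneg)

lemma q_times_tail: "j < m \<Longrightarrow> q (Suc j) * tail j = 1 + q (Suc j) * tail (Suc j)"
  using q_pos[of "Suc j"] by (simp add: tail_Suc distrib_left)

lemma condition_H_iff: "condition_H m n q \<longleftrightarrow> (\<forall>i\<in>{1..m}. real n / tail 0 \<le> q i)"
  by (simp add: condition_H_def tail_def)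

abbreviation candidates :: "nat set" where
  "candidates \<equiv> {j\<in>{1..m}. q j * tail j < real n - real j}"

lemma frame_index_eq: "r = (if condition_H m n q then 0 else Max candidates)"
  by (simp add: frame_index_def tail_def)

text \<open>
  Some weight, hence also the smallest weight \<open>q 1\<close>, lies below \<open>n / tail 0\<close>; splitting off the
  first term of \<open>tail 0\<close> turns this into the defining inequality for \<open>j = 1\<close>.
\<close>

lemma one_is_candidate:
  assumes "\<not> condition_H m n q"
  shows "1 \<in> candidates"
proof -
  obtain i where i: "i \<in> {1..m}" "q i < real n / tail 0"
    using assms by (auto simp: condition_H_iff not_le)
  have "q 1 \<le> q i" using i n_pos n_le_m by (intro q_mono) auto
  then have "q 1 < real n / tail 0" using i(2) by linarith
  then have "q 1 * tail 0 < real n"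
    using tail_pos[of 0] n_pos n_le_m by (simp add: field_simps)
  then show ?thesis
    using q_times_tail[of 0] n_pos n_le_m by auto
qed

lemma frame_index_candidate:
  assumes "\<not> condition_H m n q"
  shows "r \<in> candidates"
proof -
  have "candidates \<noteq> {}" using one_is_candidate[OF assms] by blast
  then have "Max candidates \<in> candidates" by (intro Max_in) auto
  then show ?thesis using assms by (simp add: frame_index_eq)
qed

lemma frame_index_less: "r < n"
proof (cases "condition_H m n q")
  case True
  then show ?thesis using n_pos by (simp add: frame_index_eq)
next
  case False
  from frame_index_candidate[OF False]
  have "r \<in> {1..m}" "q r * tail r < real n - real r" by auto
  moreover have "0 \<le> q r * tail r"
    using calculation(1) q_pos tail_nonneg by (simp add: less_imp_le)
  ultimately show ?thesis by linarith
qed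

lemma level_pos: "0 < level"
  using frame_index_less n_le_m tail_pos[of r] by (simp add: level_def)

text \<open>The index itself satisfies its defining inequality, which says \<open>q r < level\<close>.\<close>

lemma below_index_less_level:
  assumes i: "i \<in> {1..r}"
  shows "q i < level"
proof -
  have "\<not> condition_H m n q" using i by (auto simp: frame_index_eq split: if_splits)
  then have r: "r \<in> {1..m}" "q r * tail r < real n - real r"
    using frame_index_candidate by auto
  have "tail r > 0" using frame_index_less n_le_m by (intro tail_pos) simp
  then have "q r < level" using r(2) by (simp add: level_def pos_less_divide_eq)
  moreover have "q i \<le> q r" using i r(1) by (intro q_mono) auto
  ultimately show ?thesis by linarith
qed

text \<open>
  If condition (H) holds, then \<open>r = 0\<close> and the claim is (H) itself. Otherwise \<open>r + 1\<close> violates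
  the defining inequality of the index by maximality; adding the term for \<open>k = r + 1\<close> to the tail
  sum, this says \<open>level \<le> q (r + 1)\<close>.
\<close>

lemma level_le_above_index:
  assumes i: "i \<in> {r+1..m}"
  shows "level \<le> q i"
proof (cases "condition_H m n q")
  case True
  then show ?thesis
    using i by (simp add: level_def condition_H_iff frame_index_eq)
next
  case False
  have rm: "r < m" using frame_index_less n_le_m by simp
  have "Suc r \<notin> candidates"
  proof
    assume "Suc r \<in> candidates"
    then have "Suc r \<le> Max candidates" by (intro Max_ge) auto
    then show False using False by (simp add: frame_index_eq)
  qed
  then have "real n - real (Suc r) \<le> q (Suc r) * tail (Suc r)"
    using rm by auto
  then have "real n - real r \<le> q (Suc r) * tail r"
    using q_times_tail[OF rm] by simp
  then have "level \<le> q (Suc r)"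
    using tail_pos[OF rm] by (simp add: level_def pos_divide_le_eq)
  moreover have "q (Suc r) \<le> q i" using i by (intro q_mono) auto
  ultimately show ?thesis by linarith
qed

definition cap :: "nat \<Rightarrow> real" where "cap i = min 1 (level / q i)"

lemma cap_below: "i \<in> {1..r} \<Longrightarrow> cap i = 1"
  using below_index_less_level[of i] q_pos[of i] frame_index_less n_le_m
  by (auto simp: cap_def min_def field_simps)

lemma cap_above: "i \<in> {r+1..m} \<Longrightarrow> cap i = level / q i"
  using level_le_above_index[of i] q_pos[of i] by (auto simp: cap_def min_def field_simps)

lemma cap_bounds: "i \<in> {1..m} \<Longrightarrow> 0 \<le> cap i \<and> cap i \<le> 1"
  using level_pos q_pos[of i] by (simp add: cap_def)

lemma cap_antimono:
  assumes "i \<in> {1..m}" "j \<in> {1..m}" "i \<le> j"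
  shows "cap j \<le> cap i"
proof -
  have "level / q j \<le> level / q i"
    using assms level_pos q_pos q_mono by (intro divide_left_mono mult_pos_pos) auto
  then show ?thesis by (auto simp: cap_def min_def)
qed

lemma sum_cap: "(\<Sum>i=1..m. cap i) = real n"
proof -
  have "{1..m} = {1..r} \<union> {r+1..m}" using frame_index_less n_le_m by auto
  then have "(\<Sum>i=1..m. cap i) = (\<Sum>i\<in>{1..r}. cap i) + (\<Sum>i\<in>{r+1..m}. cap i)"
    by (simp only:) (rule sum.union_disjoint; auto)
  also have "(\<Sum>i\<in>{1..r}. cap i) = real r" by (simp add: cap_below)
  also have "(\<Sum>i\<in>{r+1..m}. cap i) = level * tail r"
  proof -
    have "(\<Sum>i\<in>{r+1..m}. cap i) = (\<Sum>i\<in>{r+1..m}. level * (1 / q i))"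
      by (rule sum.cong[OF refl]) (simp add: cap_above)
    then show ?thesis by (simp only: tail_def sum_distrib_left)
  qed
  also have "level * tail r = real n - real r"
    using tail_pos[of r] frame_index_less n_le_m by (simp add: level_def)
  finally show ?thesis by simp
qed

section \<open>Optimal frames\<close>

lemma d_err_le_iff: "d_err m p f \<le> x \<longleftrightarrow> (\<forall>i\<in>{1..m}. q i * (norm (f i))\<^sup>2 \<le> x)"
  unfolding d_err_alt using n_pos n_le_m by (subst Max_le_iff) auto

text \<open>
  An error of at most \<open>level\<close> bounds every squared norm by its cap; the two families have the same
  sum, so no bound can be strict.
\<close>

lemma norms_eq_cap_if_d_err_le:
  fixes f :: "nat \<Rightarrow> real ^ 'n"
  assumes n: "CARD('n) = n" and f: "f \<in> parseval_frames m" and le: "d_err m p f \<le> level"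
  shows "\<forall>i\<in>{1..m}. (norm (f i))\<^sup>2 = cap i"
proof -
  have "(norm (f i))\<^sup>2 \<le> cap i" if "i \<in> {1..m}" for i
  proof -
    have "q i * (norm (f i))\<^sup>2 \<le> level" using le that by (simp only: d_err_le_iff)
    then have "(norm (f i))\<^sup>2 \<le> level / q i"
      using q_pos[OF that] by (simp add: pos_le_divide_eq mult.commute)
    then show ?thesis
      using parseval_norm_le_1[OF f that] by (simp add: cap_def)
  qed
  moreover have "(\<Sum>i=1..m. (norm (f i))\<^sup>2) = (\<Sum>i=1..m. cap i)"
    by (simp only: parseval_sum_norms[OF f] n sum_cap)
  ultimately have "(norm (f i))\<^sup>2 = cap i" if "i \<in> {1..m}" for i
    using that by (intro sum_mono_inv[of "\<lambda>i. (norm (f i))\<^sup>2" "{1..m}" cap]) auto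
  then show ?thesis by blast
qed

text \<open>The maximum is attained at every index beyond \<open>r\<close>, in particular at \<open>m\<close>.\<close>

lemma d_err_eq_level_if_norms_eq_cap:
  fixes f :: "nat \<Rightarrow> real ^ 'n"
  assumes norms: "\<forall>i\<in>{1..m}. (norm (f i))\<^sup>2 = cap i"
  shows "d_err m p f = level"
proof (rule antisym)
  have "q i * cap i \<le> level" if "i \<in> {1..m}" for i
  proof -
    have "q i * cap i \<le> q i * (level / q i)"
      using q_pos[OF that] by (intro mult_left_mono) (auto simp: cap_def)
    then show ?thesis using q_pos[OF that] by simp
  qed
  then show "d_err m p f \<le> level"
    using norms by (simp only: d_err_le_iff) simp
next
  have m: "m \<in> {1..m}" "m \<in> {r+1..m}" using frame_index_less n_pos n_le_m by auto
  have "level = q m * (norm (f m))\<^sup>2"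
    using norms m q_pos[OF m(1)] by (simp add: cap_above)
  also have "\<dots> \<le> d_err m p f"
    using d_err_le_iff[of f "d_err m p f"] m(1) by blast
  finally show "level \<le> d_err m p f" .
qed

lemma level_le_d_err:
  fixes f :: "nat \<Rightarrow> real ^ 'n"
  assumes "CARD('n) = n" "f \<in> parseval_frames m"
  shows "level \<le> d_err m p f"
  using norms_eq_cap_if_d_err_le[OF assms] d_err_eq_level_if_norms_eq_cap[of f] by linarith

lemma e_err_eq_level:
  assumes n: "CARD('n::finite) = n"
  shows "e_err TYPE('n) m p = level"
proof -
  obtain g :: "nat \<Rightarrow> real ^ 'n" where g: "g \<in> parseval_frames m"
    and "\<forall>i\<in>{1..m}. (norm (g i))\<^sup>2 = cap i"
    using parseval_frame_with_norms_exists[of m cap, where 'n = 'n]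
      n n_le_m cap_bounds cap_antimono sum_cap by blast
  then have "d_err m p g = level"
    using d_err_eq_level_if_norms_eq_cap by blast
  then have "level \<in> d_err m p ` (parseval_frames m :: (nat \<Rightarrow> real ^ 'n) set)"
    using g by (metis imageI)
  then show ?thesis
    unfolding e_err_def using level_le_d_err[OF n] by (intro cInf_eq_minimum) auto
qed

lemma optimal_iff_norms_eq_cap:
  fixes f :: "nat \<Rightarrow> real ^ 'n"
  assumes "CARD('n) = n" "f \<in> parseval_frames m"
  shows "f \<in> optimal_frames m p \<longleftrightarrow> (\<forall>i\<in>{1..m}. (norm (f i))\<^sup>2 = cap i)"
  using assms norms_eq_cap_if_d_err_le[OF assms] d_err_eq_level_if_norms_eq_cap[of f]
  by (auto simp: optimal_frames_def e_err_eq_level)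

end

theorem theorem4p8:
  fixes m :: nat and p :: "nat \<Rightarrow> real" and f :: "nat \<Rightarrow> real ^ 'n"
  assumes "CARD('n) \<le> m"
    and "\<forall>i\<in>{1..m}. 0 < p i \<and> p i < 1"
    and "\<forall>i\<in>{1..m}. \<forall>j\<in>{1..m}. i \<le> j \<longrightarrow> p i \<le> p j"
    and "f \<in> parseval_frames m"
  shows "f \<in> optimal_frames m p \<longleftrightarrow>
    (\<forall>i\<in>{frame_index m CARD('n) p + 1..m}.
       (norm (f i))\<^sup>2 =
         (real CARD('n) - real (frame_index m CARD('n) p)) /
         (ptilde m p i * (\<Sum>k = frame_index m CARD('n) p + 1..m. 1 / ptilde m p k))) \<and>
    (\<forall>i\<in>{1..frame_index m CARD('n) p}. norm (f i) = 1)"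
proof -
  interpret weights m "CARD('n)" p
    using assms(1-3) by unfold_locales (auto simp: Suc_le_eq)
  have above: "cap i = (real CARD('n) - real r) / (q i * (\<Sum>k = r + 1..m. 1 / q k))"
    if "i \<in> {r+1..m}" for i
    using cap_above[OF that] by (simp add: level_def tail_def mult.commute)
  have below: "(norm (f i))\<^sup>2 = cap i \<longleftrightarrow> norm (f i) = 1" if "i \<in> {1..r}" for i
    using cap_below[OF that] by (simp add: power2_eq_1_iff) (use norm_ge_zero[of "f i"] in linarith)
  have "{1..m} = {r+1..m} \<union> {1..r}" using frame_index_less assms(1) by auto
  then have "f \<in> optimal_frames m p \<longleftrightarrow>
      (\<forall>i\<in>{r+1..m}. (norm (f i))\<^sup>2 = cap i) \<and> (\<forall>i\<in>{1..r}. (norm (f i))\<^sup>2 = cap i)"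
    using optimal_iff_norms_eq_cap[OF refl assms(4)] by (simp only: ball_Un)
  then show ?thesis by (simp only: above below cong: ball_cong)
qed

end
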